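(* Let $\gamma:I\to\mathbb{R}^3$ be a non-degenerate curve with curvature $\kappa$ and torsion $\tau$. Suppose that $\tau(t)\neq0$ for all $t\in I$ and that $$h(t):=\frac{|\dot\gamma(t)|\tau(t)}{\kappa(t)}-\frac{d}{dt}\left(\frac{\dot\kappa(t)}{\kappa^2(t)}\,\frac{1}{|\dot\gamma(t)|\tau(t)}\right)\neq0$$ for all $t\in I$, and put $\lambda^E=1/\kappa$ and $\eta^E=-\dot\kappa/(|\dot\gamma|\kappa^2\tau)$. Let $\mathrm{Ev}(\gamma)=\gamma+\lambda^E n+\eta^E b$ be the evolute of $\gamma$, with curvature $\kappa^E$. For a smooth map $(\lambda^I,\eta^I):I\to\mathbb{R}^2$ with $\eta^I(t)\ne0$ for all $t\in I$, consider the condition $$(\ast)\quad \left|\tfrac{d}{dt}\mathrm{Ev}(\gamma)\right|+\dot\lambda^I-\eta^I\left|\tfrac{d}{dt}\mathrm{Ev}(\gamma)\right|\kappa^E=0,\qquad \lambda^I\left|\tfrac{d}{dt}\mathrm{Ev}(\gamma)\right|\kappa^E+\dot\eta^I=0\quad\text{on } I.$$ When $(\ast)$ holds, let $\mathrm{Inv}(\mathrm{Ev}(\gamma))$ be the involute of $\mathrm{Ev}(\gamma)$ determined by $(\lambda^I,\eta^I)$. (i) Suppose that $\tau>0$ and $h>0$ on $I$ and there exists such a map $(\lambda^I,\eta^I)$ with $(\lambda^I+\eta^E,\eta^I-\lambda^E)\not\equiv(0,0)$ for which $(\ast)$ holds. Then $\gamma$ and $\mathrm{Inv}(\mathrm{Ev}(\gamma))$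 are $(n,b,\overline t)$-mates. (ii) Suppose that $\tau>0$ and $h<0$ on $I$ and there exists such a map $(\lambda^I,\eta^I)$ with $(\lambda^I-\eta^E,\eta^I+\lambda^E)\not\equiv(0,0)$ for which $(\ast)$ holds. Then $\gamma$ and $\mathrm{Inv}(\mathrm{Ev}(\gamma))$ are $(n,b,\overline t)$-mates. (iii) Suppose that $\tau<0$ and $h>0$ on $I$ and there exists such a map $(\lambda^I,\eta^I)$ with $(\lambda^I+\eta^E,\eta^I+\lambda^E)\not\equiv(0,0)$ for which $(\ast)$ holds. Then $\gamma$ and $\mathrm{Inv}(\mathrm{Ev}(\gamma))$ are $(n,b,\overline t)$-mates. (iv) Suppose that $\tau<0$ and $h<0$ on $I$ and there exists such a map $(\lambda^I,\eta^I)$ with $(\lambda^I-\eta^E,\eta^I-\lambda^E)\not\equiv(0,0)$ for which $(\ast)$ holds. Then $\gamma$ and $\mathrm{Inv}(\mathrm{Ev}(\gamma))$ are $(n,b,\overline t)$-mates.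
   Context: All maps are $C^\infty$; $I\subset\mathbb{R}$ is an interval. A smooth curve $\gamma:I\to\mathbb{R}^3$ is non-degenerate if it is regular ($\dot\gamma(t)\neq0$ for all $t$) and $\dot\gamma(t)\times\ddot\gamma(t)\neq 0$ for all $t\in I$. For such a curve, the tangent, bi-normal and principal normal vectors are $t=\dot\gamma/|\dot\gamma|$, $b=(\dot\gamma\times\ddot\gamma)/|\dot\gamma\times\ddot\gamma|$, $n=b\times t$, the curvature is $\kappa=|\dot\gamma\times\ddot\gamma|/|\dot\gamma|^3$ and the torsion is $\tau=\det(\dot\gamma,\ddot\gamma,\dddot\gamma)/|\dot\gamma\times\ddot\gamma|^2$ (the letter $t$ also denotes the parameter). Under the stated hypotheses $\mathrm{Ev}(\gamma)$ is again a non-degenerate curve with nowhere vanishing torsion. Involute: for a non-degenerate curve $\beta$ with nowhere vanishing torsion, curvature $\kappa_\beta$ and Frenet frame $\{t_\beta,n_\beta,b_\beta\}$, and a smooth map $(\lambda^I,\eta^I):I\to\mathbb{R}^2$ with $\eta^I(t)\neq0$ for all $t$ satisfying $|\dot\beta|+\dot\lambda^I-\eta^I|\dot\beta|\kappa_\beta=0$ and $\lambda^I|\dot\beta|\kappa_\beta+\dot\eta^I=0$ on $I$, the involute of $\beta$ determined by $(\lambda^I,\eta^I)$ is $\mathrm{Inv}(\beta)=\beta+\lambda^I t_\beta+\eta^I n_\beta$. Two non-degenerate curves $\gamma,\overline\gamma:I\to\mathbb{R}^3$ with Frenet frames $\{t,n,b\}$, $\{\overline t,\overline n,\overline b\}$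 are $(n,b,\overline t)$-mates if there exists a smooth map $(\lambda,\eta):I\to\mathbb{R}^2$ with $(\lambda,\eta)\not\equiv(0,0)$ such that $\overline\gamma=\gamma+\lambda n+\eta b$ and $n\times b=\pm\overline t$ on $I$. For a map $f:I\to\mathbb{R}^2$, $f\not\equiv(0,0)$ means that $f$ is not identically zero on any non-trivial subinterval of $I$. *)

theory Defs
  imports "HOL-Analysis.Analysis"
begin

text \<open>
  The interval I may contain its endpoints; derivatives are taken within I, hence are one-sided
  there. On an interval with at least two points they are unique and depend only on the values
  of the function on I. The same operator serves real-valued and vector-valued functions.
\<close>

definition deriv_on :: "real set \<Rightarrow> (real \<Rightarrow> 'a::real_normed_vector) \<Rightarrow> real \<Rightarrow> 'a" where
  "deriv_on I f t = vector_derivative f (at t within I)"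

definition smooth_map_on :: "real set \<Rightarrow> (real \<Rightarrow> 'a::real_normed_vector) \<Rightarrow> bool" where
  "smooth_map_on I f \<longleftrightarrow> (\<forall>k. ((deriv_on I ^^ k) f) differentiable_on I)"

definition nontrivial_interval :: "real set \<Rightarrow> bool" where
  "nontrivial_interval I \<longleftrightarrow> is_interval I \<and> (\<exists>x\<in>I. \<exists>y\<in>I. x \<noteq> y)"

definition nowhere_identically_zero_on :: "real set \<Rightarrow> (real \<Rightarrow> real \<times> real) \<Rightarrow> bool" where
  "nowhere_identically_zero_on I f \<longleftrightarrow>
     (\<forall>J. J \<subseteq> I \<and> nontrivial_interval J \<longrightarrow> (\<exists>t\<in>J. f t \<noteq> (0, 0)))"

definition nondegenerate_curve :: "real set \<Rightarrow> (real \<Rightarrow> real ^ 3) \<Rightarrow> bool" where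
  "nondegenerate_curve I \<gamma> \<longleftrightarrow> smooth_map_on I \<gamma> \<and>
     (\<forall>t\<in>I. deriv_on I \<gamma> t \<noteq> 0) \<and>
     (\<forall>t\<in>I. cross3 (deriv_on I \<gamma> t) (deriv_on I (deriv_on I \<gamma>) t) \<noteq> 0)"

definition speed :: "real set \<Rightarrow> (real \<Rightarrow> real ^ 3) \<Rightarrow> real \<Rightarrow> real" where
  "speed I \<gamma> t = norm (deriv_on I \<gamma> t)"

definition frenet_t :: "real set \<Rightarrow> (real \<Rightarrow> real ^ 3) \<Rightarrow> real \<Rightarrow> real ^ 3" where
  "frenet_t I \<gamma> t = deriv_on I \<gamma> t /\<^sub>R norm (deriv_on I \<gamma> t)"

definition frenet_b :: "real set \<Rightarrow> (real \<Rightarrow> real ^ 3) \<Rightarrow> real \<Rightarrow> real ^ 3" where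
  "frenet_b I \<gamma> t =
     cross3 (deriv_on I \<gamma> t) (deriv_on I (deriv_on I \<gamma>) t) /\<^sub>R
       norm (cross3 (deriv_on I \<gamma> t) (deriv_on I (deriv_on I \<gamma>) t))"

definition frenet_n :: "real set \<Rightarrow> (real \<Rightarrow> real ^ 3) \<Rightarrow> real \<Rightarrow> real ^ 3" where
  "frenet_n I \<gamma> t = cross3 (frenet_b I \<gamma> t) (frenet_t I \<gamma> t)"

definition curvature :: "real set \<Rightarrow> (real \<Rightarrow> real ^ 3) \<Rightarrow> real \<Rightarrow> real" where
  "curvature I \<gamma> t =
     norm (cross3 (deriv_on I \<gamma> t) (deriv_on I (deriv_on I \<gamma>) t)) / norm (deriv_on I \<gamma> t) ^ 3"

definition torsion :: "real set \<Rightarrow> (real \<Rightarrow> real ^ 3) \<Rightarrow> real \<Rightarrow> real" where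
  "torsion I \<gamma> t =
     det (vector [deriv_on I \<gamma> t, deriv_on I (deriv_on I \<gamma>) t,
                  deriv_on I (deriv_on I (deriv_on I \<gamma>)) t] :: real ^ 3 ^ 3) /
     norm (cross3 (deriv_on I \<gamma> t) (deriv_on I (deriv_on I \<gamma>) t)) ^ 2"

definition evolute_lambda :: "real set \<Rightarrow> (real \<Rightarrow> real ^ 3) \<Rightarrow> real \<Rightarrow> real" where
  "evolute_lambda I \<gamma> t = 1 / curvature I \<gamma> t"

definition evolute_eta :: "real set \<Rightarrow> (real \<Rightarrow> real ^ 3) \<Rightarrow> real \<Rightarrow> real" where
  "evolute_eta I \<gamma> t =
     - deriv_on I (curvature I \<gamma>) t / (speed I \<gamma> t * (curvature I \<gamma> t)\<^sup>2 * torsion I \<gamma> t)"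

definition evolute :: "real set \<Rightarrow> (real \<Rightarrow> real ^ 3) \<Rightarrow> real \<Rightarrow> real ^ 3" where
  "evolute I \<gamma> t =
     \<gamma> t + evolute_lambda I \<gamma> t *\<^sub>R frenet_n I \<gamma> t + evolute_eta I \<gamma> t *\<^sub>R frenet_b I \<gamma> t"

definition evolute_h :: "real set \<Rightarrow> (real \<Rightarrow> real ^ 3) \<Rightarrow> real \<Rightarrow> real" where
  "evolute_h I \<gamma> t =
     speed I \<gamma> t * torsion I \<gamma> t / curvature I \<gamma> t -
     deriv_on I (\<lambda>s. deriv_on I (curvature I \<gamma>) s / (curvature I \<gamma> s)\<^sup>2 *
                     (1 / (speed I \<gamma> s * torsion I \<gamma> s))) t"

definition involute_condition ::
    "real set \<Rightarrow> (real \<Rightarrow> real ^ 3) \<Rightarrow> (real \<Rightarrow> real) \<Rightarrow> (real \<Rightarrow> real) \<Rightarrow> bool" where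
  "involute_condition I \<beta> lam eta \<longleftrightarrow>
     smooth_map_on I (\<lambda>t. (lam t, eta t)) \<and> (\<forall>t\<in>I. eta t \<noteq> 0) \<and>
     (\<forall>t\<in>I. speed I \<beta> t + deriv_on I lam t - eta t * speed I \<beta> t * curvature I \<beta> t = 0) \<and>
     (\<forall>t\<in>I. lam t * speed I \<beta> t * curvature I \<beta> t + deriv_on I eta t = 0)"

definition involute ::
    "real set \<Rightarrow> (real \<Rightarrow> real ^ 3) \<Rightarrow> (real \<Rightarrow> real) \<Rightarrow> (real \<Rightarrow> real) \<Rightarrow> real \<Rightarrow> real ^ 3" where
  "involute I \<beta> lam eta t = \<beta> t + lam t *\<^sub>R frenet_t I \<beta> t + eta t *\<^sub>R frenet_n I \<beta> t"

text \<open>The sign in the condition relating the frames is the same at all points of I.\<close>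

definition nbt_mates :: "real set \<Rightarrow> (real \<Rightarrow> real ^ 3) \<Rightarrow> (real \<Rightarrow> real ^ 3) \<Rightarrow> bool" where
  "nbt_mates I \<gamma> \<delta> \<longleftrightarrow> nondegenerate_curve I \<gamma> \<and> nondegenerate_curve I \<delta> \<and>
     (\<exists>lam eta. smooth_map_on I (\<lambda>t. (lam t, eta t)) \<and>
        nowhere_identically_zero_on I (\<lambda>t. (lam t, eta t)) \<and>
        (\<forall>t\<in>I. \<delta> t = \<gamma> t + lam t *\<^sub>R frenet_n I \<gamma> t + eta t *\<^sub>R frenet_b I \<gamma> t) \<and>
        ((\<forall>t\<in>I. cross3 (frenet_n I \<gamma> t) (frenet_b I \<gamma> t) = frenet_t I \<delta> t) \<or>
         (\<forall>t\<in>I. cross3 (frenet_n I \<gamma> t) (frenet_b I \<gamma> t) = - frenet_t I \<delta> t)))"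

end

theory Submission
  imports Defs
begin

text \<open>
  Let \<open>T\<close>, \<open>N\<close>, \<open>B\<close> be the Frenet frame of \<open>\<gamma>\<close> and \<open>v\<close> its speed. A curve
  \<open>\<gamma> + p N + q B\<close> in the normal planes has the velocity
  \<open>v (1 - p \<kappa>) T + (p' - q v \<tau>) N + (q' + p v \<tau>) B\<close>. Both the evolute and its involute are of
  this kind.

  For the evolute \<open>p = 1 / \<kappa>\<close> kills the \<open>T\<close>-part, the choice of \<open>q\<close> kills the \<open>N\<close>-part, and
  the \<open>B\<close>-part is \<open>h\<close>. So the velocity of the evolute is \<open>h B\<close>, and since \<open>B' = - v \<tau> N\<close> its
  tangent is \<open>sgn h B\<close>, its principal normal is \<open>- sgn (\<tau> h) N\<close>, its speed is \<open>\<bar>h\<bar>\<close>, and speed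
  times curvature is \<open>v \<bar>\<tau>\<bar>\<close>. An involute of the evolute therefore stays in the normal planes of
  \<open>\<gamma>\<close>, with \<open>p = 1 / \<kappa> - sgn (\<tau> h) \<eta>\<^sup>I\<close> and \<open>q = \<eta>\<^sup>E + sgn h \<lambda>\<^sup>I\<close>. The two involute equations
  say exactly that the \<open>N\<close>- and \<open>B\<close>-parts of its velocity are zero, which leaves the velocity
  \<open>sgn (\<tau> h) \<eta>\<^sup>I v \<kappa> T\<close>. This vanishes nowhere, and as \<open>\<eta>\<^sup>I\<close> cannot change sign on an interval,
  the tangent of the involute is \<open>T = N \<times> B\<close> up to one fixed sign. The four cases of the theorem
  are the four values of \<open>(sgn \<tau>, sgn h)\<close>; in each of them the function required not to vanish
  identically is \<open>(p, q)\<close> up to the order and the signs of its components.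

  Two tools carry this: the Frenet formulas, derived below from the determinant definition of the
  torsion, and the lemma \<open>frame_of_adapted_pair\<close>, which reads off the Frenet data of a curve from
  a velocity \<open>a X\<close> with \<open>X' = c Y\<close>. It serves once with \<open>X = B\<close> and once with \<open>X = T\<close>.
\<close>

section \<open>Finite orders of differentiability\<close>

text \<open>Closure of smooth maps under products, reciprocals and square roots cannot be proved by
  induction inside smoothness itself, because the derivative of \<open>1 / f\<close> contains \<open>1 / f\<close> again.
  Counting the derivatives removes the circle: order \<open>k + 1\<close> of \<open>1 / f\<close> follows from order \<open>k\<close>.\<close>

primrec diff_order :: "nat \<Rightarrow> real set \<Rightarrow> (real \<Rightarrow> 'a::real_normed_vector) \<Rightarrow> bool" where
  "diff_order 0 I f \<longleftrightarrow> True"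
| "diff_order (Suc k) I f \<longleftrightarrow> f differentiable_on I \<and> diff_order k I (deriv_on I f)"

lemma deriv_on_cong:
  assumes "\<And>s. s \<in> I \<Longrightarrow> f s = g s" and "t \<in> I"
  shows "deriv_on I f t = deriv_on I g t"
proof -
  have "(f has_vector_derivative D) (at t within I) \<longleftrightarrow>
        (g has_vector_derivative D) (at t within I)" for D
    using assms by (metis has_vector_derivative_transform)
  then show ?thesis
    by (simp add: deriv_on_def vector_derivative_def)
qed

lemma diff_order_cong:
  "(\<And>s. s \<in> I \<Longrightarrow> f s = g s) \<Longrightarrow> diff_order k I f \<longleftrightarrow> diff_order k I g"
proof (induction k arbitrary: f g)
  case (Suc k)
  have "f differentiable_on I \<longleftrightarrow> g differentiable_on I"
    unfolding differentiable_on_def using Suc.prems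
    by (metis differentiableI_vector has_vector_derivative_transform vector_derivative_works)
  moreover have "diff_order k I (deriv_on I f) \<longleftrightarrow> diff_order k I (deriv_on I g)"
    by (rule Suc.IH) (rule deriv_on_cong[OF Suc.prems])
  ultimately show ?case by simp
qed simp

lemma diff_order_Suc_imp: "diff_order (Suc k) I f \<Longrightarrow> diff_order k I f"
  by (induction k arbitrary: f) auto

lemma diff_order_has_deriv:
  "diff_order (Suc k) I f \<Longrightarrow> t \<in> I \<Longrightarrow> (f has_vector_derivative deriv_on I f t) (at t within I)"
  by (simp add: differentiable_on_def deriv_on_def vector_derivative_works[symmetric])

lemma smooth_iff_diff_order: "smooth_map_on I f \<longleftrightarrow> (\<forall>k. diff_order k I f)"
proof -
  have "diff_order k I f \<longleftrightarrow> (\<forall>j<k. ((deriv_on I ^^ j) f) differentiable_on I)" for k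
  proof (induction k arbitrary: f)
    case (Suc k)
    show ?case
      by (simp add: Suc.IH All_less_Suc2 funpow_swap1)
  qed simp
  then show ?thesis
    unfolding smooth_map_on_def by blast
qed

lemma smooth_cong:
  "(\<And>s. s \<in> I \<Longrightarrow> f s = g s) \<Longrightarrow> smooth_map_on I f \<longleftrightarrow> smooth_map_on I g"
  unfolding smooth_iff_diff_order using diff_order_cong by metis

lemma smooth_has_deriv:
  "smooth_map_on I f \<Longrightarrow> t \<in> I \<Longrightarrow> (f has_vector_derivative deriv_on I f t) (at t within I)"
  unfolding smooth_iff_diff_order by (rule diff_order_has_deriv) blast

lemma smooth_deriv_on: "smooth_map_on I f \<Longrightarrow> smooth_map_on I (deriv_on I f)"
  unfolding smooth_iff_diff_order by (metis diff_order.simps(2))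

lemma smooth_continuous_on: "smooth_map_on I f \<Longrightarrow> continuous_on I f"
  by (meson continuous_on_vector_derivative smooth_has_deriv)

section \<open>Closure properties of smooth maps on an interval\<close>

text \<open>An interval with two points has no isolated points, so one-sided derivatives are unique.\<close>

locale curve_domain =
  fixes I :: "real set"
  assumes interval: "nontrivial_interval I"
begin

lemma within_neq_bot:
  assumes "t \<in> I"
  shows "at t within I \<noteq> bot"
proof -
  obtain x y where "x \<in> I" "y \<in> I" "x \<noteq> y" and conn: "connected I"
    using interval by (auto simp: nontrivial_interval_def is_interval_connected)
  then have "\<not> (\<exists>a. I = {a})" by auto
  then have "t islimpt I"
    using connected_imp_perfect[OF conn] assms by blast
  then show ?thesis
    using trivial_limit_within by blast
qed

lemma constant_sign:
  fixes f :: "real \<Rightarrow> real"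
  assumes "continuous_on I f" and "\<And>t. t \<in> I \<Longrightarrow> f t \<noteq> 0"
  shows "(\<forall>t\<in>I. f t > 0) \<or> (\<forall>t\<in>I. f t < 0)"
proof (rule ccontr)
  assume "\<not> ?thesis"
  then obtain x y where "x \<in> I" "f x \<le> 0" "y \<in> I" "f y \<ge> 0"
    by force
  moreover have "connected (f ` I)"
    using interval assms(1)
    by (intro connected_continuous_image) (auto simp: nontrivial_interval_def is_interval_connected)
  ultimately have "0 \<in> f ` I"
    using connectedD_interval[of "f ` I" "f x" "f y" 0] by blast
  then show False
    using assms(2) by auto
qed

lemma deriv_on_eq:
  "t \<in> I \<Longrightarrow> (f has_vector_derivative D) (at t within I) \<Longrightarrow> deriv_on I f t = D"
  unfolding deriv_on_def by (rule vector_derivative_within[OF within_neq_bot])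

lemma diff_order_SucI:
  assumes "\<And>t. t \<in> I \<Longrightarrow> (f has_vector_derivative g t) (at t within I)" and "diff_order k I g"
  shows "diff_order (Suc k) I f"
proof -
  have "f differentiable_on I"
    unfolding differentiable_on_def using assms(1) differentiableI_vector by blast
  moreover have "diff_order k I (deriv_on I f)"
    using diff_order_cong[of I "deriv_on I f" g k] assms deriv_on_eq by blast
  ultimately show ?thesis by simp
qed

lemma diff_order_const: "diff_order k I (\<lambda>t. c)"
proof (induction k arbitrary: c)
  case (Suc k)
  show ?case by (rule diff_order_SucI[OF _ Suc[of 0]]) simp
qed simp

lemma diff_order_add:
  "diff_order k I f \<Longrightarrow> diff_order k I g \<Longrightarrow> diff_order k I (\<lambda>t. f t + g t)"
proof (induction k arbitrary: f g)
  case (Suc k)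
  show ?case
  proof (rule diff_order_SucI)
    show "((\<lambda>t. f t + g t) has_vector_derivative deriv_on I f t + deriv_on I g t) (at t within I)"
      if "t \<in> I" for t
      by (intro has_vector_derivative_add diff_order_has_deriv[OF Suc.prems(1) that]
          diff_order_has_deriv[OF Suc.prems(2) that])
  qed (use Suc in simp)
qed simp

lemma diff_order_bilinear:
  assumes "bounded_bilinear p"
  shows "diff_order k I f \<Longrightarrow> diff_order k I g \<Longrightarrow> diff_order k I (\<lambda>t. p (f t) (g t))"
proof (induction k arbitrary: f g)
  case (Suc k)
  show ?case
  proof (rule diff_order_SucI)
    show "((\<lambda>t. p (f t) (g t)) has_vector_derivative
        p (f t) (deriv_on I g t) + p (deriv_on I f t) (g t)) (at t within I)"
      if "t \<in> I" for t
      by (intro bounded_bilinear.has_vector_derivative[OF assms]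
          diff_order_has_deriv[OF Suc.prems(1) that] diff_order_has_deriv[OF Suc.prems(2) that])
    show "diff_order k I (\<lambda>t. p (f t) (deriv_on I g t) + p (deriv_on I f t) (g t))"
      using Suc by (intro diff_order_add Suc.IH diff_order_Suc_imp[OF Suc.prems(1)]
          diff_order_Suc_imp[OF Suc.prems(2)]) auto
  qed
qed simp

lemma diff_order_linear:
  assumes "bounded_linear L"
  shows "diff_order k I f \<Longrightarrow> diff_order k I (\<lambda>t. L (f t))"
proof (induction k arbitrary: f)
  case (Suc k)
  show ?case
  proof (rule diff_order_SucI)
    show "((\<lambda>t. L (f t)) has_vector_derivative L (deriv_on I f t)) (at t within I)"
      if "t \<in> I" for t
      by (intro bounded_linear.has_vector_derivative[OF assms]
          diff_order_has_deriv[OF Suc.prems that])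
  qed (use Suc in simp)
qed simp

lemmas diff_order_mult = diff_order_bilinear[OF bounded_bilinear_mult]

lemma diff_order_inverse:
  fixes f :: "real \<Rightarrow> real"
  shows "diff_order k I f \<Longrightarrow> (\<And>t. t \<in> I \<Longrightarrow> f t \<noteq> 0) \<Longrightarrow> diff_order k I (\<lambda>t. inverse (f t))"
proof (induction k)
  case (Suc k)
  show ?case
  proof (rule diff_order_SucI)
    show "((\<lambda>t. inverse (f t)) has_vector_derivative
        - 1 * (deriv_on I f t * (inverse (f t) * inverse (f t)))) (at t within I)"
      if "t \<in> I" for t
      unfolding has_real_derivative_iff_has_vector_derivative[symmetric]
      using diff_order_has_deriv[OF Suc.prems(1) that] Suc.prems(2)[OF that]
      by (auto simp: has_real_derivative_iff_has_vector_derivative[symmetric]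
          intro!: derivative_eq_intros)
    have "diff_order k I (\<lambda>t. inverse (f t))"
      using Suc.IH[OF diff_order_Suc_imp[OF Suc.prems(1)]] Suc.prems(2) by blast
    then show "diff_order k I (\<lambda>t. - 1 * (deriv_on I f t * (inverse (f t) * inverse (f t))))"
      using Suc.prems(1) by (intro diff_order_mult diff_order_const) auto
  qed
qed simp

lemma diff_order_sqrt:
  shows "diff_order k I f \<Longrightarrow> (\<And>t. t \<in> I \<Longrightarrow> f t > 0) \<Longrightarrow> diff_order k I (\<lambda>t. sqrt (f t))"
proof (induction k)
  case (Suc k)
  show ?case
  proof (rule diff_order_SucI)
    show "((\<lambda>t. sqrt (f t)) has_vector_derivative
        1 / 2 * (deriv_on I f t * inverse (sqrt (f t)))) (at t within I)"
      if "t \<in> I" for t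
      unfolding has_real_derivative_iff_has_vector_derivative[symmetric]
      using diff_order_has_deriv[OF Suc.prems(1) that] Suc.prems(2)[OF that]
      by (auto simp: has_real_derivative_iff_has_vector_derivative[symmetric] divide_simps
          intro!: derivative_eq_intros)
    have "diff_order k I (\<lambda>t. sqrt (f t))"
      using Suc.IH[OF diff_order_Suc_imp[OF Suc.prems(1)]] Suc.prems(2) by blast
    then have "diff_order k I (\<lambda>t. inverse (sqrt (f t)))"
      using Suc.prems(2) by (intro diff_order_inverse) force+
    then show "diff_order k I (\<lambda>t. 1 / 2 * (deriv_on I f t * inverse (sqrt (f t))))"
      using Suc.prems(1) by (intro diff_order_mult diff_order_const) auto
  qed
qed simp

lemma smooth_const: "smooth_map_on I (\<lambda>t. c)"
  by (simp add: smooth_iff_diff_order diff_order_const)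

lemma smooth_add:
  "smooth_map_on I f \<Longrightarrow> smooth_map_on I g \<Longrightarrow> smooth_map_on I (\<lambda>t. f t + g t)"
  by (simp add: smooth_iff_diff_order diff_order_add)

lemma smooth_bilinear:
  "bounded_bilinear p \<Longrightarrow> smooth_map_on I f \<Longrightarrow> smooth_map_on I g \<Longrightarrow>
   smooth_map_on I (\<lambda>t. p (f t) (g t))"
  by (simp add: smooth_iff_diff_order diff_order_bilinear)

lemma smooth_linear:
  "bounded_linear L \<Longrightarrow> smooth_map_on I f \<Longrightarrow> smooth_map_on I (\<lambda>t. L (f t))"
  by (simp add: smooth_iff_diff_order diff_order_linear)

lemmas smooth_mult = smooth_bilinear[OF bounded_bilinear_mult]
lemmas smooth_scaleR = smooth_bilinear[OF bounded_bilinear_scaleR]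
lemmas smooth_inner = smooth_bilinear[OF bounded_bilinear_inner]
lemmas smooth_cross =
  smooth_bilinear[OF bilinear_cross[unfolded bilinear_conv_bounded_bilinear]]
lemmas smooth_minus = smooth_linear[OF bounded_linear_minus[OF bounded_linear_ident]]

lemma smooth_power: "smooth_map_on I f \<Longrightarrow> smooth_map_on I (\<lambda>t. f t ^ n :: real)"
  by (induction n) (simp_all add: smooth_const smooth_mult)

lemma smooth_divide:
  fixes f g :: "real \<Rightarrow> real"
  assumes "smooth_map_on I f" "smooth_map_on I g" "\<And>t. t \<in> I \<Longrightarrow> g t \<noteq> 0"
  shows "smooth_map_on I (\<lambda>t. f t / g t)"
  using smooth_mult[of f "\<lambda>t. inverse (g t)"] assms
  by (simp add: smooth_iff_diff_order diff_order_inverse divide_inverse)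

lemma smooth_norm:
  fixes f :: "real \<Rightarrow> 'a::real_inner"
  assumes "smooth_map_on I f" "\<And>t. t \<in> I \<Longrightarrow> f t \<noteq> 0"
  shows "smooth_map_on I (\<lambda>t. norm (f t))"
  using smooth_inner[OF assms(1) assms(1)] assms(2)
  by (simp add: smooth_iff_diff_order diff_order_sqrt norm_eq_sqrt_inner)

lemma smooth_normalize:
  fixes f :: "real \<Rightarrow> 'a::real_inner"
  assumes "smooth_map_on I f" "\<And>t. t \<in> I \<Longrightarrow> f t \<noteq> 0"
  shows "smooth_map_on I (\<lambda>t. f t /\<^sub>R norm (f t))"
  using smooth_scaleR[OF smooth_divide[OF smooth_const[of 1] smooth_norm[OF assms]] assms(1)] assms(2)
  by (simp add: divide_inverse)

lemma smooth_Pair: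
  fixes f :: "real \<Rightarrow> 'a::real_normed_vector" and g :: "real \<Rightarrow> 'b::real_normed_vector"
  assumes "smooth_map_on I f" "smooth_map_on I g"
  shows "smooth_map_on I (\<lambda>t. (f t, g t))"
proof -
  have "smooth_map_on I (\<lambda>t. (f t, 0) + (0, g t))"
    by (intro smooth_add smooth_linear[where L = "\<lambda>x. (x, 0)"] smooth_linear[where L = "\<lambda>x. (0, x)"]
        bounded_linear_Pair bounded_linear_ident bounded_linear_zero assms)
  then show ?thesis by simp
qed

lemma smooth_fst: "smooth_map_on I (\<lambda>t. (f t, g t)) \<Longrightarrow> smooth_map_on I f"
  by (drule smooth_linear[OF bounded_linear_fst]) simp

lemma smooth_snd: "smooth_map_on I (\<lambda>t. (f t, g t)) \<Longrightarrow> smooth_map_on I g"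
  by (drule smooth_linear[OF bounded_linear_snd]) simp

end

section \<open>The Frenet formulas\<close>

lemma cross_cross_cancel:
  fixes x y :: "real ^ 3"
  assumes "norm x = 1" and "x \<bullet> y = 0"
  shows "cross3 (cross3 x y) x = y" and "norm (cross3 x y) = norm y"
proof -
  have "x \<bullet> x = 1"
    using assms(1) by (simp add: norm_eq_1)
  then show "cross3 (cross3 x y) x = y"
    using Lagrange[of x x y] cross_skew[of "cross3 x y" x] assms(2) by simp
  show "norm (cross3 x y) = norm y"
    using norm_cross_dot[of x y] assms by simp
qed

text \<open>If \<open>\<delta>' = a X\<close> and \<open>X' = c Y\<close> with \<open>X\<close>, \<open>Y\<close> orthonormal, then
  \<open>\<delta>' \<times> \<delta>'' = a\<^sup>2 c (X \<times> Y)\<close>, so \<open>X\<close>, \<open>Y\<close>, \<open>X \<times> Y\<close> is the Frenet frame of \<open>\<delta>\<close> up to signs.\<close>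

lemma (in curve_domain) frame_of_adapted_pair:
  fixes \<delta> X Y :: "real \<Rightarrow> real ^ 3"
  assumes smooth: "smooth_map_on I \<delta>" "smooth_map_on I a"
    and \<delta>': "\<And>t. t \<in> I \<Longrightarrow> (\<delta> has_vector_derivative a t *\<^sub>R X t) (at t within I)"
    and X': "\<And>t. t \<in> I \<Longrightarrow> (X has_vector_derivative c t *\<^sub>R Y t) (at t within I)"
    and unit: "\<And>t. t \<in> I \<Longrightarrow> norm (X t) = 1" "\<And>t. t \<in> I \<Longrightarrow> norm (Y t) = 1"
      "\<And>t. t \<in> I \<Longrightarrow> X t \<bullet> Y t = 0"
    and nz: "\<And>t. t \<in> I \<Longrightarrow> a t \<noteq> 0" "\<And>t. t \<in> I \<Longrightarrow> c t \<noteq> 0"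
  shows "nondegenerate_curve I \<delta>"
    and "t \<in> I \<Longrightarrow> speed I \<delta> t = \<bar>a t\<bar>"
    and "t \<in> I \<Longrightarrow> curvature I \<delta> t = \<bar>c t\<bar> / \<bar>a t\<bar>"
    and "t \<in> I \<Longrightarrow> frenet_t I \<delta> t = sgn (a t) *\<^sub>R X t"
    and "t \<in> I \<Longrightarrow> frenet_n I \<delta> t = (sgn (c t) * sgn (a t)) *\<^sub>R Y t"
proof -
  have d1: "deriv_on I \<delta> t = a t *\<^sub>R X t" if "t \<in> I" for t
    using deriv_on_eq[OF that \<delta>'[OF that]] .
  have d2: "deriv_on I (deriv_on I \<delta>) t = (a t * c t) *\<^sub>R Y t + deriv_on I a t *\<^sub>R X t" if "t \<in> I" for t
  proof -
    have "((\<lambda>t. a t *\<^sub>R X t) has_vector_derivative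
        a t *\<^sub>R c t *\<^sub>R Y t + deriv_on I a t *\<^sub>R X t) (at t within I)"
      by (intro bounded_bilinear.has_vector_derivative[OF bounded_bilinear_scaleR]
          smooth_has_deriv smooth X' that)
    then show ?thesis
      using deriv_on_cong[OF d1 that] deriv_on_eq[OF that] by simp
  qed
  have cr: "cross3 (deriv_on I \<delta> t) (deriv_on I (deriv_on I \<delta>) t)
      = ((a t)\<^sup>2 * c t) *\<^sub>R cross3 (X t) (Y t)" if "t \<in> I" for t
    by (simp add: d1 d2 that cross_add_right cross_mult_left cross_mult_right power2_eq_square)
  have XY: "norm (cross3 (X t) (Y t)) = 1" "cross3 (cross3 (X t) (Y t)) (X t) = Y t"
    if "t \<in> I" for t
    using cross_cross_cancel[of "X t" "Y t"] unit[OF that] by auto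
  show "nondegenerate_curve I \<delta>"
    unfolding nondegenerate_curve_def
  proof (intro conjI ballI smooth)
    fix t assume t: "t \<in> I"
    show "deriv_on I \<delta> t \<noteq> 0"
      using unit(1) nz t by (force simp: d1)
    show "cross3 (deriv_on I \<delta> t) (deriv_on I (deriv_on I \<delta>) t) \<noteq> 0"
      using XY(1)[OF t] nz[OF t] by (auto simp: cr[OF t])
  qed
  assume t: "t \<in> I"
  note [simp] = d1[OF t] cr[OF t] XY[OF t] unit[OF t] nz[OF t]
  show "speed I \<delta> t = \<bar>a t\<bar>"
    by (simp add: speed_def)
  show "curvature I \<delta> t = \<bar>c t\<bar> / \<bar>a t\<bar>"
    unfolding curvature_def cr[OF t]
    by (simp add: abs_mult power2_eq_square power3_eq_cube)
  show ft: "frenet_t I \<delta> t = sgn (a t) *\<^sub>R X t"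
    by (simp add: frenet_t_def sgn_div_norm divide_inverse mult.commute)
  have fb: "frenet_b I \<delta> t = sgn (c t) *\<^sub>R cross3 (X t) (Y t)"
  proof -
    have "(a t)\<^sup>2 * c t / \<bar>(a t)\<^sup>2 * c t\<bar> = sgn (c t)"
      using nz[OF t] by (simp add: abs_mult real_sgn_eq)
    then show ?thesis
      unfolding frenet_b_def cr[OF t] by (simp add: divide_inverse mult.commute)
  qed
  show "frenet_n I \<delta> t = (sgn (c t) * sgn (a t)) *\<^sub>R Y t"
    unfolding frenet_n_def ft fb by (simp add: cross_mult_left cross_mult_right)
qed

locale space_curve = curve_domain +
  fixes \<gamma> :: "real \<Rightarrow> real ^ 3"
  assumes nondegenerate: "nondegenerate_curve I \<gamma>"
begin

abbreviation "v \<equiv> speed I \<gamma>"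
abbreviation "\<kappa> \<equiv> curvature I \<gamma>"
abbreviation "\<tau> \<equiv> torsion I \<gamma>"
abbreviation "T \<equiv> frenet_t I \<gamma>"
abbreviation "N \<equiv> frenet_n I \<gamma>"
abbreviation "B \<equiv> frenet_b I \<gamma>"
abbreviation "w \<equiv> \<lambda>t. cross3 (deriv_on I \<gamma> t) (deriv_on I (deriv_on I \<gamma>) t)"

lemma smooth_\<gamma>: "smooth_map_on I \<gamma>"
  and velocity_nz: "t \<in> I \<Longrightarrow> deriv_on I \<gamma> t \<noteq> 0"
  and w_nz: "t \<in> I \<Longrightarrow> w t \<noteq> 0"
  using nondegenerate by (auto simp: nondegenerate_curve_def)

lemma v_pos: "t \<in> I \<Longrightarrow> v t > 0"
  using velocity_nz by (simp add: speed_def)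

lemma \<kappa>_pos: "t \<in> I \<Longrightarrow> \<kappa> t > 0"
  using velocity_nz w_nz by (simp add: curvature_def)

lemma smooth_w: "smooth_map_on I w"
  by (intro smooth_cross smooth_deriv_on smooth_\<gamma>)

lemma smooth_v: "smooth_map_on I v"
  unfolding speed_def[abs_def] using velocity_nz
  by (intro smooth_norm smooth_deriv_on smooth_\<gamma>)

lemma smooth_\<kappa>: "smooth_map_on I \<kappa>"
  unfolding curvature_def[abs_def] using w_nz velocity_nz
  by (intro smooth_divide smooth_power smooth_norm smooth_w smooth_deriv_on smooth_\<gamma>) auto

lemma smooth_T: "smooth_map_on I T"
  unfolding frenet_t_def[abs_def] using velocity_nz
  by (intro smooth_normalize smooth_deriv_on smooth_\<gamma>)

lemma smooth_B: "smooth_map_on I B"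
  unfolding frenet_b_def[abs_def] using w_nz by (intro smooth_normalize smooth_w)

lemma smooth_N: "smooth_map_on I N"
  unfolding frenet_n_def[abs_def] by (intro smooth_cross smooth_T smooth_B)

lemma orthonormal:
  assumes "t \<in> I"
  shows "T t \<bullet> T t = 1" "N t \<bullet> N t = 1" "B t \<bullet> B t = 1"
    and "T t \<bullet> B t = 0" "T t \<bullet> N t = 0" "N t \<bullet> B t = 0"
proof -
  have "norm (T t) = 1" "norm (B t) = 1"
    using velocity_nz[OF assms] w_nz[OF assms] by (simp_all add: frenet_t_def frenet_b_def)
  moreover show TB: "T t \<bullet> B t = 0"
    by (simp add: frenet_t_def frenet_b_def dot_cross_self)
  ultimately show "T t \<bullet> T t = 1" "N t \<bullet> N t = 1" "B t \<bullet> B t = 1"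
    using cross_cross_cancel(2)[of "B t" "T t"]
    by (simp_all add: norm_eq_1[symmetric] frenet_n_def inner_commute)
  show "T t \<bullet> N t = 0" "N t \<bullet> B t = 0"
    by (simp_all add: frenet_n_def dot_cross_self)
qed

lemma cross_frame:
  assumes "t \<in> I"
  shows "cross3 (N t) (B t) = T t" "cross3 (B t) (N t) = - T t" "cross3 (N t) (T t) = - B t"
    "cross3 (B t) (T t) = N t"
proof -
  show "cross3 (N t) (B t) = T t"
    using cross_cross_cancel(1)[of "B t" "T t"] orthonormal[OF assms]
    by (simp add: frenet_n_def norm_eq_1 inner_commute)
  then show "cross3 (B t) (N t) = - T t"
    using cross_skew by metis
  have "cross3 (T t) (N t) = B t"
    using Lagrange[of "T t" "B t" "T t"] orthonormal[OF assms] by (simp add: frenet_n_def)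
  then show "cross3 (N t) (T t) = - B t"
    using cross_skew by metis
  show "cross3 (B t) (T t) = N t"
    by (simp add: frenet_n_def)
qed

lemma deriv_inner_const:
  fixes X Y :: "real \<Rightarrow> real ^ 3"
  assumes "smooth_map_on I X" "smooth_map_on I Y" "\<And>s. s \<in> I \<Longrightarrow> X s \<bullet> Y s = c" "t \<in> I"
  shows "X t \<bullet> deriv_on I Y t + deriv_on I X t \<bullet> Y t = 0"
proof -
  have "((\<lambda>t. X t \<bullet> Y t) has_vector_derivative
      X t \<bullet> deriv_on I Y t + deriv_on I X t \<bullet> Y t) (at t within I)"
    by (intro bounded_bilinear.has_vector_derivative[OF bounded_bilinear_inner]
        smooth_has_deriv assms)
  moreover have "((\<lambda>t. X t \<bullet> Y t) has_vector_derivative 0) (at t within I)"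
    by (rule has_vector_derivative_transform[OF assms(4,3) has_vector_derivative_const])
  ultimately show ?thesis
    using deriv_on_eq[OF assms(4)] by metis
qed

lemma velocity: "t \<in> I \<Longrightarrow> deriv_on I \<gamma> t = v t *\<^sub>R T t"
  using velocity_nz by (simp add: speed_def frenet_t_def)

lemma acceleration:
  assumes "t \<in> I"
  shows "deriv_on I (deriv_on I \<gamma>) t = v t *\<^sub>R deriv_on I T t + deriv_on I v t *\<^sub>R T t"
proof -
  have "((\<lambda>t. v t *\<^sub>R T t) has_vector_derivative
      v t *\<^sub>R deriv_on I T t + deriv_on I v t *\<^sub>R T t) (at t within I)"
    by (intro bounded_bilinear.has_vector_derivative[OF bounded_bilinear_scaleR]
        smooth_has_deriv smooth_v smooth_T assms)
  then show ?thesis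
    using deriv_on_cong[OF velocity assms] deriv_on_eq[OF assms] by simp
qed

lemma frenet_T:
  assumes t: "t \<in> I"
  shows "deriv_on I T t = (v t * \<kappa> t) *\<^sub>R N t"
proof -
  have TT': "T t \<bullet> deriv_on I T t = 0"
    using deriv_inner_const[OF smooth_T smooth_T orthonormal(1) t] by (simp add: inner_commute)
  have w: "w t = (v t)\<^sup>2 *\<^sub>R cross3 (T t) (deriv_on I T t)"
    by (simp add: velocity acceleration t cross_add_right cross_mult_left cross_mult_right
        power2_eq_square)
  have "w t = norm (w t) *\<^sub>R B t"
    using w_nz[OF t] by (simp add: frenet_b_def)
  also have "norm (w t) = (v t)\<^sup>2 * (v t * \<kappa> t)"
    using v_pos[OF t] by (simp add: curvature_def speed_def power2_eq_square power3_eq_cube)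
  finally have "(v t)\<^sup>2 *\<^sub>R cross3 (T t) (deriv_on I T t) = (v t)\<^sup>2 *\<^sub>R (v t * \<kappa> t) *\<^sub>R B t"
    unfolding w by simp
  then have "cross3 (T t) (deriv_on I T t) = (v t * \<kappa> t) *\<^sub>R B t"
    using v_pos[OF t] by (metis less_numeral_extra(3) scaleR_cancel_left zero_eq_power2)
  then show ?thesis
    using cross_cross_cancel(1)[of "T t" "deriv_on I T t"] TT' orthonormal(1)[OF t]
    by (simp add: norm_eq_1 cross_mult_left frenet_n_def)
qed

text \<open>Differentiating \<open>B \<bullet> \<gamma>'' = 0\<close> moves the third derivative of \<open>\<gamma>\<close> in the torsion onto \<open>B'\<close>.\<close>

lemma torsion_eq:
  assumes t: "t \<in> I"
  shows "v t * \<tau> t = - (deriv_on I B t \<bullet> N t)"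
proof -
  have acc: "deriv_on I (deriv_on I \<gamma>) s = ((v s)\<^sup>2 * \<kappa> s) *\<^sub>R N s + deriv_on I v s *\<^sub>R T s"
    if "s \<in> I" for s
    by (simp add: acceleration frenet_T that power2_eq_square)
  have "B s \<bullet> deriv_on I (deriv_on I \<gamma>) s = 0" if "s \<in> I" for s
    by (simp add: acc that inner_right_distrib orthonormal inner_commute[of "B s"])
  from deriv_inner_const[OF smooth_B _ this t]
  have third: "B t \<bullet> deriv_on I (deriv_on I (deriv_on I \<gamma>)) t
      = - (deriv_on I B t \<bullet> deriv_on I (deriv_on I \<gamma>) t)"
    using smooth_\<gamma> by (simp add: smooth_deriv_on)
  have "deriv_on I B t \<bullet> T t = 0"
    using deriv_inner_const[OF smooth_T smooth_B orthonormal(4) t]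
    by (simp add: frenet_T t orthonormal inner_commute[of "deriv_on I B t"])
  then have third': "B t \<bullet> deriv_on I (deriv_on I (deriv_on I \<gamma>)) t
      = - ((v t)\<^sup>2 * \<kappa> t) * (deriv_on I B t \<bullet> N t)"
    unfolding third acc[OF t] by (simp add: inner_right_distrib)
  have nw: "norm (w t) = (v t) ^ 3 * \<kappa> t"
    using v_pos[OF t] by (simp add: curvature_def speed_def)
  have "det (vector [deriv_on I \<gamma> t, deriv_on I (deriv_on I \<gamma>) t,
      deriv_on I (deriv_on I (deriv_on I \<gamma>)) t]) = w t \<bullet> deriv_on I (deriv_on I (deriv_on I \<gamma>)) t"
    by (metis cross_triple dot_cross_det inner_commute)
  also have "w t = norm (w t) *\<^sub>R B t"
    using w_nz[OF t] by (simp add: frenet_b_def)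
  finally have "\<tau> t = (B t \<bullet> deriv_on I (deriv_on I (deriv_on I \<gamma>)) t) / norm (w t)"
    using w_nz[OF t] by (simp add: torsion_def power2_eq_square)
  then show ?thesis
    unfolding third' nw using v_pos[OF t] \<kappa>_pos[OF t]
    by (simp add: field_simps power2_eq_square power3_eq_cube)
qed

lemma frenet_B:
  assumes t: "t \<in> I"
  shows "deriv_on I B t = (- v t * \<tau> t) *\<^sub>R N t"
proof -
  have 1: "deriv_on I B t \<bullet> T t = 0"
    using deriv_inner_const[OF smooth_T smooth_B orthonormal(4) t]
    by (simp add: frenet_T t orthonormal inner_commute[of "deriv_on I B t"])
  have 2: "deriv_on I B t \<bullet> B t = 0"
    using deriv_inner_const[OF smooth_B smooth_B orthonormal(3) t] by (simp add: inner_commute)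
  \<comment> \<open>Being orthogonal to \<open>T\<close> and \<open>B\<close>, the vector \<open>B'\<close> is parallel to \<open>N = B \<times> T\<close>.\<close>
  have "cross3 (deriv_on I B t) (N t) = 0"
    unfolding frenet_n_def by (simp add: Lagrange 1 2)
  with Lagrange[of "N t" "deriv_on I B t" "N t"] orthonormal(2)[OF t]
  show ?thesis
    using torsion_eq[OF t] by (simp add: inner_commute)
qed

lemma frenet_N:
  assumes t: "t \<in> I"
  shows "deriv_on I N t = (v t * \<tau> t) *\<^sub>R B t - (v t * \<kappa> t) *\<^sub>R T t"
proof (rule deriv_on_eq[OF t])
  have "((\<lambda>t. cross3 (B t) (T t)) has_vector_derivative
      cross3 (B t) (deriv_on I T t) + cross3 (deriv_on I B t) (T t)) (at t within I)"
    by (intro bounded_bilinear.has_vector_derivative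
        [OF bilinear_cross[unfolded bilinear_conv_bounded_bilinear]]
        smooth_has_deriv smooth_B smooth_T t)
  then show "(N has_vector_derivative (v t * \<tau> t) *\<^sub>R B t - (v t * \<kappa> t) *\<^sub>R T t) (at t within I)"
    unfolding frenet_n_def[abs_def]
    by (simp add: frenet_T frenet_B t cross_mult_left cross_mult_right cross_frame)
qed

lemma smooth_\<tau>: "smooth_map_on I \<tau>"
proof -
  have "smooth_map_on I (\<lambda>t. - (deriv_on I B t \<bullet> N t) / v t)"
    by (intro smooth_divide smooth_minus smooth_inner smooth_deriv_on
        smooth_B smooth_N smooth_v less_imp_neq[OF v_pos, symmetric])
  moreover have "- (deriv_on I B t \<bullet> N t) / v t = \<tau> t" if "t \<in> I" for t
    using torsion_eq[OF that] v_pos[OF that] by (simp add: field_simps)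
  ultimately show ?thesis
    using smooth_cong by (metis (mono_tags, lifting))
qed

lemma deriv_normal_offset:
  assumes t: "t \<in> I" and "smooth_map_on I p" "smooth_map_on I q"
  shows "((\<lambda>t. \<gamma> t + p t *\<^sub>R N t + q t *\<^sub>R B t) has_vector_derivative
      (v t * (1 - p t * \<kappa> t)) *\<^sub>R T t + (deriv_on I p t - q t * v t * \<tau> t) *\<^sub>R N t
      + (deriv_on I q t + p t * v t * \<tau> t) *\<^sub>R B t) (at t within I)"
proof -
  have "((\<lambda>t. \<gamma> t + p t *\<^sub>R N t + q t *\<^sub>R B t) has_vector_derivative
      deriv_on I \<gamma> t + (p t *\<^sub>R deriv_on I N t + deriv_on I p t *\<^sub>R N t)
      + (q t *\<^sub>R deriv_on I B t + deriv_on I q t *\<^sub>R B t)) (at t within I)"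
    by (intro has_vector_derivative_add smooth_has_deriv smooth_\<gamma> smooth_N smooth_B
        bounded_bilinear.has_vector_derivative[OF bounded_bilinear_scaleR] assms)
  then show ?thesis
    by (rule has_vector_derivative_eq_rhs)
       (simp add: velocity frenet_N frenet_B t algebra_simps)
qed

end

section \<open>The evolute and its involutes\<close>

locale twisted_curve = space_curve +
  assumes torsion_nz: "t \<in> I \<Longrightarrow> torsion I \<gamma> t \<noteq> 0"
begin

abbreviation "lamE \<equiv> evolute_lambda I \<gamma>"
abbreviation "etaE \<equiv> evolute_eta I \<gamma>"
abbreviation "h \<equiv> evolute_h I \<gamma>"

lemma smooth_lamE: "smooth_map_on I lamE"
  unfolding evolute_lambda_def[abs_def]
  by (intro smooth_divide smooth_const smooth_\<kappa> less_imp_neq[OF \<kappa>_pos, symmetric])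

lemma smooth_etaE: "smooth_map_on I etaE"
  unfolding evolute_eta_def[abs_def]
proof (intro smooth_divide smooth_minus smooth_deriv_on smooth_mult smooth_power
    smooth_v smooth_\<kappa> smooth_\<tau>)
  show "v t * (\<kappa> t)\<^sup>2 * \<tau> t \<noteq> 0" if "t \<in> I" for t
    using v_pos[OF that] \<kappa>_pos[OF that] torsion_nz[OF that] by simp
qed

lemma deriv_lamE:
  assumes t: "t \<in> I"
  shows "deriv_on I lamE t = etaE t * v t * \<tau> t"
proof (rule deriv_on_eq[OF t])
  have "((\<lambda>t. 1 / \<kappa> t) has_vector_derivative - deriv_on I \<kappa> t / (\<kappa> t)\<^sup>2) (at t within I)"
    using smooth_has_deriv[OF smooth_\<kappa> t] \<kappa>_pos[OF t]
    by (auto simp: has_real_derivative_iff_has_vector_derivative[symmetric] power2_eq_square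
        intro!: derivative_eq_intros)
  moreover have "etaE t * v t * \<tau> t = - deriv_on I \<kappa> t / (\<kappa> t)\<^sup>2"
    using v_pos[OF t] torsion_nz[OF t] by (simp add: evolute_eta_def)
  ultimately show "(lamE has_vector_derivative etaE t * v t * \<tau> t) (at t within I)"
    by (simp add: evolute_lambda_def[abs_def])
qed

lemma deriv_etaE:
  assumes t: "t \<in> I"
  shows "h t = v t * \<tau> t * lamE t + deriv_on I etaE t"
proof -
  define q where "q s = deriv_on I \<kappa> s / (\<kappa> s)\<^sup>2 * (1 / (v s * \<tau> s))" for s
  have q: "q = (\<lambda>s. - etaE s)"
    by (auto simp: q_def evolute_eta_def)
  have "deriv_on I q t = - deriv_on I etaE t"
    unfolding q by (intro deriv_on_eq has_vector_derivative_minus smooth_has_deriv smooth_etaE t)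
  then show ?thesis
    by (simp add: evolute_h_def q_def[abs_def] evolute_lambda_def)
qed

lemma smooth_h: "smooth_map_on I h"
  using smooth_cong[OF deriv_etaE]
  by (simp add: smooth_add smooth_mult smooth_v smooth_\<tau> smooth_lamE smooth_etaE smooth_deriv_on)

lemma smooth_evolute: "smooth_map_on I (evolute I \<gamma>)"
  unfolding evolute_def[abs_def]
  by (intro smooth_add smooth_scaleR smooth_\<gamma> smooth_lamE smooth_etaE smooth_N smooth_B)

text \<open>The coefficients of the evolute are chosen so that its velocity has no tangential and no
  principal normal part; what remains is \<open>h\<close>.\<close>

lemma deriv_evolute:
  assumes t: "t \<in> I"
  shows "(evolute I \<gamma> has_vector_derivative h t *\<^sub>R B t) (at t within I)"
proof -
  have "1 - lamE t * \<kappa> t = 0"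
    using \<kappa>_pos[OF t] by (simp add: evolute_lambda_def)
  then show ?thesis
    using deriv_normal_offset[OF t smooth_lamE smooth_etaE]
    by (simp add: evolute_def[abs_def] deriv_lamE deriv_etaE t algebra_simps)
qed

lemma evolute_frame:
  assumes h_nz: "\<forall>t\<in>I. h t \<noteq> 0" and t: "t \<in> I"
  shows "speed I (evolute I \<gamma>) t = \<bar>h t\<bar>"
    and "speed I (evolute I \<gamma>) t * curvature I (evolute I \<gamma>) t = v t * \<bar>\<tau> t\<bar>"
    and "frenet_t I (evolute I \<gamma>) t = sgn (h t) *\<^sub>R B t"
    and "frenet_n I (evolute I \<gamma>) t = - (sgn (\<tau> t) * sgn (h t)) *\<^sub>R N t"
proof -
  have B': "(B has_vector_derivative (- v t * \<tau> t) *\<^sub>R N t) (at t within I)" if "t \<in> I" for t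
    using smooth_has_deriv[OF smooth_B that] frenet_B[OF that] by simp
  have nz: "- v t * \<tau> t \<noteq> 0" if "t \<in> I" for t
    using v_pos[OF that] torsion_nz[OF that] by simp
  have on: "norm (B t) = 1" "norm (N t) = 1" "B t \<bullet> N t = 0" if "t \<in> I" for t
    using orthonormal[OF that] by (simp_all add: norm_eq_1 inner_commute)
  note F = frame_of_adapted_pair[OF smooth_evolute smooth_h deriv_evolute B' on bspec[OF h_nz] nz]
  show "speed I (evolute I \<gamma>) t = \<bar>h t\<bar>"
    and "frenet_t I (evolute I \<gamma>) t = sgn (h t) *\<^sub>R B t"
    using F(2,4) t by simp_all
  show "speed I (evolute I \<gamma>) t * curvature I (evolute I \<gamma>) t = v t * \<bar>\<tau> t\<bar>"
    using F(2,3) t bspec[OF h_nz t] v_pos[OF t] by (simp add: abs_mult)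
  show "frenet_n I (evolute I \<gamma>) t = - (sgn (\<tau> t) * sgn (h t)) *\<^sub>R N t"
    using F(5) t v_pos[OF t] by (simp add: sgn_mult)
qed

lemma nowhere_identically_zero_mono:
  assumes "nowhere_identically_zero_on I f" and "\<And>t. f t \<noteq> (0, 0) \<Longrightarrow> g t \<noteq> (0, 0)"
  shows "nowhere_identically_zero_on I g"
  using assms unfolding nowhere_identically_zero_on_def by meson

text \<open>With the frame of the evolute inserted, the two involute equations say exactly that the
  binormal and the principal normal part of the velocity vanish, so the velocity is a multiple of
  \<open>T\<close>.\<close>

lemma involute_of_evolute_is_mate:
  assumes \<sigma>: "\<bar>\<sigma>\<bar> = 1" "\<And>t. t \<in> I \<Longrightarrow> sgn (\<tau> t) = \<sigma>"
    and \<rho>: "\<bar>\<rho>\<bar> = 1" "\<And>t. t \<in> I \<Longrightarrow> sgn (h t) = \<rho>"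
    and cond: "involute_condition I (evolute I \<gamma>) lam eta"
    and nonzero: "nowhere_identically_zero_on I (\<lambda>t. (lamE t - \<sigma> * \<rho> * eta t, etaE t + \<rho> * lam t))"
  shows "nbt_mates I \<gamma> (involute I (evolute I \<gamma>) lam eta)"
proof -
  define \<delta> where "\<delta> = involute I (evolute I \<gamma>) lam eta"
  define p where "p t = lamE t - \<sigma> * \<rho> * eta t" for t
  define q where "q t = etaE t + \<rho> * lam t" for t
  define a where "a t = \<sigma> * \<rho> * eta t * (v t * \<kappa> t)" for t
  have h_nz: "\<forall>t\<in>I. h t \<noteq> 0"
    using \<rho> by fastforce
  note E = evolute_frame[OF h_nz]
  have sq: "\<sigma> * \<sigma> = 1" "\<rho> * \<rho> = 1"
    using \<sigma>(1) \<rho>(1) by (simp_all flip: power2_eq_square add: abs_square_eq_1)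
  have abs_\<tau>: "\<bar>\<tau> t\<bar> = \<sigma> * \<tau> t" and abs_h: "\<bar>h t\<bar> = \<rho> * h t" if "t \<in> I" for t
    using \<sigma>(2)[OF that] \<rho>(2)[OF that] by (simp_all add: abs_sgn mult.commute)
  have lam: "smooth_map_on I lam" and eta: "smooth_map_on I eta"
    and eta_nz: "\<And>t. t \<in> I \<Longrightarrow> eta t \<noteq> 0"
    using cond smooth_fst smooth_snd by (auto simp: involute_condition_def)
  have lam': "deriv_on I lam t = eta t * v t * \<sigma> * \<tau> t - \<rho> * h t"
    and eta': "deriv_on I eta t = - lam t * v t * \<sigma> * \<tau> t" if t: "t \<in> I" for t
    using cond t E(1,2)[OF t] abs_\<tau>[OF t] abs_h[OF t]
    by (auto simp: involute_condition_def mult.assoc algebra_simps)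
  have smooth_p: "smooth_map_on I p" and smooth_q: "smooth_map_on I q"
  proof -
    have "smooth_map_on I (\<lambda>t. lamE t + (- \<sigma> * \<rho>) * eta t)" "smooth_map_on I (\<lambda>t. etaE t + \<rho> * lam t)"
      by (intro smooth_add smooth_mult smooth_const smooth_lamE smooth_etaE lam eta)+
    then show "smooth_map_on I p" "smooth_map_on I q"
      by (simp_all add: p_def[abs_def] q_def[abs_def])
  qed
  have p': "deriv_on I p t = deriv_on I lamE t - \<sigma> * \<rho> * deriv_on I eta t"
    and q': "deriv_on I q t = deriv_on I etaE t + \<rho> * deriv_on I lam t" if t: "t \<in> I" for t
    unfolding p_def[abs_def] q_def[abs_def]
    using smooth_has_deriv[OF smooth_lamE t] smooth_has_deriv[OF smooth_etaE t]
      smooth_has_deriv[OF lam t] smooth_has_deriv[OF eta t]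
    by (auto intro!: deriv_on_eq[OF t] derivative_eq_intros
        simp: has_real_derivative_iff_has_vector_derivative[symmetric])
  have \<delta>: "\<delta> t = \<gamma> t + p t *\<^sub>R N t + q t *\<^sub>R B t" if "t \<in> I" for t
    by (simp add: \<delta>_def p_def q_def involute_def evolute_def E(3,4) \<sigma>(2) \<rho>(2) that algebra_simps)
  have \<delta>': "(\<delta> has_vector_derivative a t *\<^sub>R T t) (at t within I)" if t: "t \<in> I" for t
  proof -
    have 1: "v t * (1 - p t * \<kappa> t) = a t"
      using \<kappa>_pos[OF t] by (simp add: p_def a_def evolute_lambda_def field_simps)
    have 2: "deriv_on I p t - q t * v t * \<tau> t = 0"
      using sq unfolding p'[OF t] q_def deriv_lamE[OF t] eta'[OF t] by algebra
    have 3: "deriv_on I q t + p t * v t * \<tau> t = 0"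
      using sq deriv_etaE[OF t] unfolding q'[OF t] p_def lam'[OF t] by algebra
    show ?thesis
      using has_vector_derivative_transform[OF t \<delta> deriv_normal_offset[OF t smooth_p smooth_q]]
      by (simp add: 1 2 3)
  qed
  have T': "(T has_vector_derivative (v t * \<kappa> t) *\<^sub>R N t) (at t within I)" if "t \<in> I" for t
    using smooth_has_deriv[OF smooth_T that] frenet_T[OF that] by simp
  have v\<kappa>: "v t * \<kappa> t > 0" if "t \<in> I" for t
    using v_pos[OF that] \<kappa>_pos[OF that] by simp
  have on: "norm (T t) = 1" "norm (N t) = 1" "T t \<bullet> N t = 0" if "t \<in> I" for t
    using orthonormal[OF that] by (simp_all add: norm_eq_1)
  have "smooth_map_on I (\<lambda>t. \<gamma> t + p t *\<^sub>R N t + q t *\<^sub>R B t)"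
    by (intro smooth_add smooth_scaleR smooth_\<gamma> smooth_p smooth_q smooth_N smooth_B)
  then have smooth_\<delta>: "smooth_map_on I \<delta>"
    using smooth_cong[OF \<delta>] by simp
  have smooth_a: "smooth_map_on I a"
    unfolding a_def[abs_def] by (intro smooth_mult smooth_const eta smooth_v smooth_\<kappa>)
  have a_nz: "a t \<noteq> 0" if "t \<in> I" for t
    using \<sigma>(1) \<rho>(1) eta_nz[OF that] v\<kappa>[OF that] by (auto simp: a_def)
  note F = frame_of_adapted_pair[OF smooth_\<delta> smooth_a \<delta>' T' on a_nz
      less_imp_neq[OF v\<kappa>, symmetric]]
  have "(\<forall>t\<in>I. a t > 0) \<or> (\<forall>t\<in>I. a t < 0)"
    using constant_sign[OF smooth_continuous_on[OF smooth_a] a_nz] .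
  then have "(\<forall>t\<in>I. cross3 (N t) (B t) = frenet_t I \<delta> t) \<or>
      (\<forall>t\<in>I. cross3 (N t) (B t) = - frenet_t I \<delta> t)"
    using F(4) by (auto simp: cross_frame)
  then show ?thesis
    unfolding nbt_mates_def \<delta>_def[symmetric]
    using nondegenerate F(1) smooth_Pair[OF smooth_p smooth_q] 
      nonzero[folded p_def q_def] \<delta> by blast
qed

end

theorem theorem5p5:
  fixes I :: "real set" and \<gamma> :: "real \<Rightarrow> real ^ 3"
  assumes "nontrivial_interval I"
    and "nondegenerate_curve I \<gamma>"
    and "\<And>t. t \<in> I \<Longrightarrow> torsion I \<gamma> t \<noteq> 0"
    and "\<And>t. t \<in> I \<Longrightarrow> evolute_h I \<gamma> t \<noteq> 0"
  shows "((\<forall>t\<in>I. torsion I \<gamma> t > 0) \<and> (\<forall>t\<in>I. evolute_h I \<gamma> t > 0) \<longrightarrow>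
       (\<forall>lam eta. involute_condition I (evolute I \<gamma>) lam eta \<and>
          nowhere_identically_zero_on I
            (\<lambda>t. (lam t + evolute_eta I \<gamma> t, eta t - evolute_lambda I \<gamma> t)) \<longrightarrow>
          nbt_mates I \<gamma> (involute I (evolute I \<gamma>) lam eta))) \<and>
     ((\<forall>t\<in>I. torsion I \<gamma> t > 0) \<and> (\<forall>t\<in>I. evolute_h I \<gamma> t < 0) \<longrightarrow>
       (\<forall>lam eta. involute_condition I (evolute I \<gamma>) lam eta \<and>
          nowhere_identically_zero_on I
            (\<lambda>t. (lam t - evolute_eta I \<gamma> t, eta t + evolute_lambda I \<gamma> t)) \<longrightarrow>
          nbt_mates I \<gamma> (involute I (evolute I \<gamma>) lam eta))) \<and>
     ((\<forall>t\<in>I. torsion I \<gamma> t < 0) \<and> (\<forall>t\<in>I. evolute_h I \<gamma> t > 0) \<longrightarrow>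
       (\<forall>lam eta. involute_condition I (evolute I \<gamma>) lam eta \<and>
          nowhere_identically_zero_on I
            (\<lambda>t. (lam t + evolute_eta I \<gamma> t, eta t + evolute_lambda I \<gamma> t)) \<longrightarrow>
          nbt_mates I \<gamma> (involute I (evolute I \<gamma>) lam eta))) \<and>
     ((\<forall>t\<in>I. torsion I \<gamma> t < 0) \<and> (\<forall>t\<in>I. evolute_h I \<gamma> t < 0) \<longrightarrow>
       (\<forall>lam eta. involute_condition I (evolute I \<gamma>) lam eta \<and>
          nowhere_identically_zero_on I
            (\<lambda>t. (lam t - evolute_eta I \<gamma> t, eta t - evolute_lambda I \<gamma> t)) \<longrightarrow>
          nbt_mates I \<gamma> (involute I (evolute I \<gamma>) lam eta)))"
proof -
  interpret twisted_curve I \<gamma>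
    using assms(1-3) by unfold_locales
  show ?thesis
  proof (intro conjI impI allI; elim conjE)
    fix lam eta
    assume "\<forall>t\<in>I. \<tau> t > 0" "\<forall>t\<in>I. h t > 0" "involute_condition I (evolute I \<gamma>) lam eta"
      "nowhere_identically_zero_on I (\<lambda>t. (lam t + etaE t, eta t - lamE t))"
    then show "nbt_mates I \<gamma> (involute I (evolute I \<gamma>) lam eta)"
      by - (rule involute_of_evolute_is_mate[of 1 1];
        (erule nowhere_identically_zero_mono)?; auto)
  next
    fix lam eta
    assume "\<forall>t\<in>I. \<tau> t > 0" "\<forall>t\<in>I. h t < 0" "involute_condition I (evolute I \<gamma>) lam eta"
      "nowhere_identically_zero_on I (\<lambda>t. (lam t - etaE t, eta t + lamE t))"
    then show "nbt_mates I \<gamma> (involute I (evolute I \<gamma>) lam eta)"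
      by - (rule involute_of_evolute_is_mate[of 1 "-1"];
        (erule nowhere_identically_zero_mono)?; auto)
  next
    fix lam eta
    assume "\<forall>t\<in>I. \<tau> t < 0" "\<forall>t\<in>I. h t > 0" "involute_condition I (evolute I \<gamma>) lam eta"
      "nowhere_identically_zero_on I (\<lambda>t. (lam t + etaE t, eta t + lamE t))"
    then show "nbt_mates I \<gamma> (involute I (evolute I \<gamma>) lam eta)"
      by - (rule involute_of_evolute_is_mate[of "-1" 1];
        (erule nowhere_identically_zero_mono)?; auto)
  next
    fix lam eta
    assume "\<forall>t\<in>I. \<tau> t < 0" "\<forall>t\<in>I. h t < 0" "involute_condition I (evolute I \<gamma>) lam eta"
      "nowhere_identically_zero_on I (\<lambda>t. (lam t - etaE t, eta t - lamE t))"
    then show "nbt_mates I \<gamma> (involute I (evolute I \<gamma>) lam eta)"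
      by - (rule involute_of_evolute_is_mate[of "-1" "-1"];
        (erule nowhere_identically_zero_mono)?; auto)
  qed
qed

end
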